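(* Fix a mode theory $\mathcal{M}$ (a strict 2-category) and consider the multimodal natural deduction system described in the context. The following two rules are admissible (i.e. whenever their premises are derivable, so is their conclusion). (Weakening) For all modes $p$, pre-contexts $\Gamma,\Delta$, modality $\mu$, formula $\varphi$ and formula $C$: if $\Gamma, (\mu \mid \varphi), \Delta \ \mathsf{ctx} \ @\, p$ and $\Gamma, \Delta \vdash C \ @\, p$ are derivable, then $\Gamma, (\mu\mid\varphi), \Delta \vdash C \ @\, p$ is derivable. (Exchange) For all modes $p$, pre-contexts $\Gamma,\Delta$, modalities $\mu,\nu$ and formulas $\varphi,\psi,C$: if $\Gamma, (\mu\mid\varphi), (\nu\mid\psi), \Delta \vdash C \ @\, p$ is derivable, then $\Gamma, (\nu\mid\psi), (\mu\mid\varphi), \Delta \vdash C \ @\, p$ is derivable.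
   Context: A mode theory is a strict 2-category $\mathcal{M}$. Its objects are called modes ($m,n,o,p,\dots$); its 1-cells $\mu : n \to m$ are called modalities, with composition $\mu\circ\nu : o \to m$ for $\nu : o\to n$, $\mu : n \to m$, and identities $1_m : m \to m$; its 2-cells $\alpha : \mu \Rightarrow \nu$ (between parallel modalities $\mu,\nu : n\to m$) are called transformations, with vertical composition $\beta\circ\alpha$, identities $1_\mu$, and horizontal composition $\alpha * \beta : \mu\circ\theta \Rightarrow \nu\circ\xi$ for $\alpha:\mu\Rightarrow\nu$, $\beta : \theta\Rightarrow\xi$, satisfying the strict 2-category laws. Formulas. Pre-formulas: $\varphi,\psi ::= p_i \mid \bot \mid \top \mid \varphi\lor\psi \mid \varphi\land\psi \mid (\mu\mid\varphi)\to\psi \mid \langle\mu\mid\varphi\rangle$ ($p_i$ propositional variables, $\mu$ a modality). The judgement "$\varphi$ wff $@\,m$" is generated by: $p_i,\top,\bot$ are wff at every mode; if $\varphi,\psi$ wff $@\,m$ then so are $\varphi\land\psi$, $\varphi\lor\psi$; if $\mu:n\to m$, $\varphi$ wff $@\,n$ and $\psi$ wff $@\,m$ then $(\mu\mid\varphi)\to\psi$ wff $@\,m$; if $\varphi$ wff $@\,n$ and $\mu:n\to m$ then $\langle\mu\mid\varphi\rangle$ wff $@\,m$. Write $\varphi\to\psi$ for $(1_m\mid\varphi)\to\psi$. Contexts. Pre-contexts: $\Gamma ::= \cdot \mid \Gamma, (\mu\mid\varphi) \mid \Gamma.\mathsf{lock}_\mu$. The judgement "$\Gamma$ ctx $@\,m$"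 is generated by: $\cdot$ ctx $@\,m$; if $\Gamma$ ctx $@\,m$, $\mu : n\to m$ and $\varphi$ wff $@\,n$ then $\Gamma,(\mu\mid\varphi)$ ctx $@\,m$; if $\Gamma$ ctx $@\,m$ and $\mu : n \to m$ then $\Gamma.\mathsf{lock}_\mu$ ctx $@\,n$. Contexts are identified modulo $\Gamma.\mathsf{lock}_{1_m} = \Gamma$ and $\Gamma.\mathsf{lock}_\mu.\mathsf{lock}_\nu = \Gamma.\mathsf{lock}_{\mu\circ\nu}$. $\Gamma,\Delta$ denotes concatenation of pre-contexts. Define $|\cdot| = 1$, $|\Gamma,(\mu\mid\varphi)| = |\Gamma|$, $|\Gamma.\mathsf{lock}_\mu| = |\Gamma|\circ\mu$. Derivability of $\Gamma\vdash\varphi\ @\,m$ is generated by the rules: (var) if $\mu : n\to m$ and $\alpha : \mu\Rightarrow |\Delta|$ then $\Gamma,(\mu\mid\varphi),\Delta \vdash \varphi\ @\,n$; ($\top$) $\Gamma\vdash\top\ @\,m$; ($\bot$E) from $\Gamma\vdash\bot\ @\,m$ infer $\Gamma\vdash\varphi\ @\,m$; ($\land$I) from $\Gamma\vdash\varphi$ and $\Gamma\vdash\psi$ infer $\Gamma\vdash\varphi\land\psi$; ($\land$E) from $\Gamma\vdash\varphi_1\land\varphi_2$ infer $\Gamma\vdash\varphi_i$; ($\lor$I) from $\Gamma\vdash\varphi_i$ infer $\Gamma\vdash\varphi_1\lor\varphi_2$; ($\lor$E) from $\Gamma\vdash\varphi\lor\psi$, $\Gamma,(1\mid\varphi)\vdash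 C$, $\Gamma,(1\mid\psi)\vdash C$ infer $\Gamma\vdash C$ (all at the same mode $m$); ($\to$I) from $\Gamma,(\mu\mid\varphi)\vdash\psi\ @\,m$ infer $\Gamma\vdash(\mu\mid\varphi)\to\psi\ @\,m$; ($\to$E) if $\mu:n\to m$, from $\Gamma\vdash(\mu\mid\varphi)\to\psi\ @\,m$ and $\Gamma.\mathsf{lock}_\mu\vdash\varphi\ @\,n$ infer $\Gamma\vdash\psi\ @\,m$; (modI) if $\mu:n\to m$, from $\Gamma.\mathsf{lock}_\mu\vdash\varphi\ @\,n$ infer $\Gamma\vdash\langle\mu\mid\varphi\rangle\ @\,m$; (modE) if $\nu:o\to n$, $\mu:n\to m$, from $\Gamma.\mathsf{lock}_\mu\vdash\langle\nu\mid\varphi\rangle\ @\,n$ and $\Gamma,(\mu\circ\nu\mid\varphi)\vdash\psi\ @\,m$ infer $\Gamma\vdash\psi\ @\,m$. *)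

theory Defs
  imports Main
begin

section \<open>Mode theories\<close>

record ('o, 'm, 't) two_cat =
  modes :: "'o set"
  modalities :: "'m set"
  src :: "'m \<Rightarrow> 'o"
  tgt :: "'m \<Rightarrow> 'o"
  id1 :: "'o \<Rightarrow> 'm"
  comp1 :: "'m \<Rightarrow> 'm \<Rightarrow> 'm"
  transformations :: "'t set"
  src2 :: "'t \<Rightarrow> 'm"
  tgt2 :: "'t \<Rightarrow> 'm"
  id2 :: "'m \<Rightarrow> 't"
  vcomp :: "'t \<Rightarrow> 't \<Rightarrow> 't"
  hcomp :: "'t \<Rightarrow> 't \<Rightarrow> 't"

definition modality :: "('o, 'm, 't) two_cat \<Rightarrow> 'm \<Rightarrow> 'o \<Rightarrow> 'o \<Rightarrow> bool" where
  "modality M \<mu> n m \<longleftrightarrow> \<mu> \<in> modalities M \<and> src M \<mu> = n \<and> tgt M \<mu> = m"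

definition transformation :: "('o, 'm, 't) two_cat \<Rightarrow> 't \<Rightarrow> 'm \<Rightarrow> 'm \<Rightarrow> bool" where
  "transformation M \<alpha> \<mu> \<nu> \<longleftrightarrow> \<alpha> \<in> transformations M \<and> src2 M \<alpha> = \<mu> \<and> tgt2 M \<alpha> = \<nu>"

text \<open>All compositions are written in applicative order: \<open>comp1 M \<mu> \<nu>\<close> is
  \<open>\<mu> \<circ> \<nu>\<close>, \<open>vcomp M \<beta> \<alpha>\<close> is \<open>\<beta> \<circ> \<alpha>\<close>, and \<open>hcomp M \<alpha> \<beta>\<close> is \<open>\<alpha> * \<beta>\<close>.\<close>

locale mode_theory =
  fixes M :: "('o, 'm, 't) two_cat"
  assumes modality_modes: "modality M \<mu> n m \<Longrightarrow> n \<in> modes M \<and> m \<in> modes M"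
    and id1_modality: "m \<in> modes M \<Longrightarrow> modality M (id1 M m) m m"
    and comp1_modality: "\<lbrakk>modality M \<mu> n m; modality M \<nu> k n\<rbrakk>
      \<Longrightarrow> modality M (comp1 M \<mu> \<nu>) k m"
    and comp1_id_left: "modality M \<mu> n m \<Longrightarrow> comp1 M (id1 M m) \<mu> = \<mu>"
    and comp1_id_right: "modality M \<mu> n m \<Longrightarrow> comp1 M \<mu> (id1 M n) = \<mu>"
    and comp1_assoc: "\<lbrakk>modality M \<mu> n m; modality M \<nu> k n; modality M \<rho> l k\<rbrakk>
      \<Longrightarrow> comp1 M (comp1 M \<mu> \<nu>) \<rho> = comp1 M \<mu> (comp1 M \<nu> \<rho>)"
    and transformation_parallel: "transformation M \<alpha> \<mu> \<nu>
      \<Longrightarrow> \<exists>n m. modality M \<mu> n m \<and> modality M \<nu> n m"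
    and id2_transformation: "modality M \<mu> n m \<Longrightarrow> transformation M (id2 M \<mu>) \<mu> \<mu>"
    and vcomp_transformation: "\<lbrakk>transformation M \<beta> \<nu> \<rho>; transformation M \<alpha> \<mu> \<nu>\<rbrakk>
      \<Longrightarrow> transformation M (vcomp M \<beta> \<alpha>) \<mu> \<rho>"
    and vcomp_id_left: "transformation M \<alpha> \<mu> \<nu> \<Longrightarrow> vcomp M (id2 M \<nu>) \<alpha> = \<alpha>"
    and vcomp_id_right: "transformation M \<alpha> \<mu> \<nu> \<Longrightarrow> vcomp M \<alpha> (id2 M \<mu>) = \<alpha>"
    and vcomp_assoc: "\<lbrakk>transformation M \<gamma> \<rho> \<sigma>; transformation M \<beta> \<nu> \<rho>;
        transformation M \<alpha> \<mu> \<nu>\<rbrakk>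
      \<Longrightarrow> vcomp M (vcomp M \<gamma> \<beta>) \<alpha> = vcomp M \<gamma> (vcomp M \<beta> \<alpha>)"
    and hcomp_transformation: "\<lbrakk>transformation M \<alpha> \<mu> \<nu>; transformation M \<beta> \<theta> \<xi>;
        src M \<mu> = tgt M \<theta>\<rbrakk>
      \<Longrightarrow> transformation M (hcomp M \<alpha> \<beta>) (comp1 M \<mu> \<theta>) (comp1 M \<nu> \<xi>)"
    and hcomp_id_left: "\<lbrakk>transformation M \<alpha> \<mu> \<nu>; modality M \<mu> n m\<rbrakk>
      \<Longrightarrow> hcomp M (id2 M (id1 M m)) \<alpha> = \<alpha>"
    and hcomp_id_right: "\<lbrakk>transformation M \<alpha> \<mu> \<nu>; modality M \<mu> n m\<rbrakk>
      \<Longrightarrow> hcomp M \<alpha> (id2 M (id1 M n)) = \<alpha>"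
    and hcomp_assoc: "\<lbrakk>transformation M \<alpha> \<mu> \<mu>'; transformation M \<beta> \<nu> \<nu>';
        transformation M \<gamma> \<rho> \<rho>'; src M \<mu> = tgt M \<nu>; src M \<nu> = tgt M \<rho>\<rbrakk>
      \<Longrightarrow> hcomp M (hcomp M \<alpha> \<beta>) \<gamma> = hcomp M \<alpha> (hcomp M \<beta> \<gamma>)"
    and hcomp_id2: "\<lbrakk>modality M \<mu> n m; modality M \<nu> k n\<rbrakk>
      \<Longrightarrow> hcomp M (id2 M \<mu>) (id2 M \<nu>) = id2 M (comp1 M \<mu> \<nu>)"
    and interchange: "\<lbrakk>transformation M \<alpha> \<mu> \<nu>; transformation M \<alpha>' \<nu> \<rho>;
        transformation M \<beta> \<theta> \<xi>; transformation M \<beta>' \<xi> \<zeta>; src M \<mu> = tgt M \<theta>\<rbrakk>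
      \<Longrightarrow> hcomp M (vcomp M \<alpha>' \<alpha>) (vcomp M \<beta>' \<beta>)
        = vcomp M (hcomp M \<alpha>' \<beta>') (hcomp M \<alpha> \<beta>)"


section \<open>Formulas and contexts\<close>

text \<open>\<open>Imp \<mu> \<phi> \<psi>\<close> is \<open>(\<mu> | \<phi>) \<rightarrow> \<psi>\<close>, and \<open>Box \<mu> \<phi>\<close> is the modal formula \<open>\<langle>\<mu> | \<phi>\<rangle>\<close>.\<close>

datatype ('p, 'm) fm =
    Var 'p
  | Bot
  | Top
  | Or "('p, 'm) fm" "('p, 'm) fm"
  | And "('p, 'm) fm" "('p, 'm) fm"
  | Imp 'm "('p, 'm) fm" "('p, 'm) fm"
  | Box 'm "('p, 'm) fm"

inductive wff :: "('o, 'm, 't) two_cat \<Rightarrow> 'o \<Rightarrow> ('p, 'm) fm \<Rightarrow> bool"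
  for M :: "('o, 'm, 't) two_cat"
where
  wff_Var: "m \<in> modes M \<Longrightarrow> wff M m (Var i)"
| wff_Bot: "m \<in> modes M \<Longrightarrow> wff M m Bot"
| wff_Top: "m \<in> modes M \<Longrightarrow> wff M m Top"
| wff_Or: "\<lbrakk>wff M m \<phi>; wff M m \<psi>\<rbrakk> \<Longrightarrow> wff M m (Or \<phi> \<psi>)"
| wff_And: "\<lbrakk>wff M m \<phi>; wff M m \<psi>\<rbrakk> \<Longrightarrow> wff M m (And \<phi> \<psi>)"
| wff_Imp: "\<lbrakk>modality M \<mu> n m; wff M n \<phi>; wff M m \<psi>\<rbrakk> \<Longrightarrow> wff M m (Imp \<mu> \<phi> \<psi>)"
| wff_Box: "\<lbrakk>modality M \<mu> n m; wff M n \<phi>\<rbrakk> \<Longrightarrow> wff M m (Box \<mu> \<phi>)"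

datatype ('p, 'm) pctx =
    Emp
  | Ext "('p, 'm) pctx" 'm "('p, 'm) fm"
  | Lock "('p, 'm) pctx" 'm

primrec cat :: "('p, 'm) pctx \<Rightarrow> ('p, 'm) pctx \<Rightarrow> ('p, 'm) pctx" where
  "cat \<Gamma> Emp = \<Gamma>"
| "cat \<Gamma> (Ext \<Delta> \<mu> \<phi>) = Ext (cat \<Gamma> \<Delta>) \<mu> \<phi>"
| "cat \<Gamma> (Lock \<Delta> \<mu>) = Lock (cat \<Gamma> \<Delta>) \<mu>"

inductive ctx :: "('o, 'm, 't) two_cat \<Rightarrow> 'o \<Rightarrow> ('p, 'm) pctx \<Rightarrow> bool"
  for M :: "('o, 'm, 't) two_cat"
where
  ctx_Emp: "m \<in> modes M \<Longrightarrow> ctx M m Emp"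
| ctx_Ext: "\<lbrakk>ctx M m \<Gamma>; modality M \<mu> n m; wff M n \<phi>\<rbrakk> \<Longrightarrow> ctx M m (Ext \<Gamma> \<mu> \<phi>)"
| ctx_Lock: "\<lbrakk>ctx M m \<Gamma>; modality M \<mu> n m\<rbrakk> \<Longrightarrow> ctx M n (Lock \<Gamma> \<mu>)"

text \<open>\<open>ctx_eq M m \<Gamma> \<Gamma>'\<close> identifies contexts at mode \<open>m\<close>: it is the congruence generated by
  the two lock equations. It must be indexed by a mode, since the empty pre-context is a
  context at every mode and \<open>Lock Emp (id1 M m)\<close> may only be identified with \<open>Emp\<close>
  at mode \<open>m\<close>.\<close>

inductive ctx_eq :: "('o, 'm, 't) two_cat \<Rightarrow> 'o \<Rightarrow> ('p, 'm) pctx \<Rightarrow> ('p, 'm) pctx \<Rightarrow> bool"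
  for M :: "('o, 'm, 't) two_cat"
where
  ctx_eq_lock_id: "ctx M m \<Gamma> \<Longrightarrow> ctx_eq M m (Lock \<Gamma> (id1 M m)) \<Gamma>"
| ctx_eq_lock_comp: "\<lbrakk>ctx M m \<Gamma>; modality M \<mu> n m; modality M \<nu> k n\<rbrakk>
    \<Longrightarrow> ctx_eq M k (Lock (Lock \<Gamma> \<mu>) \<nu>) (Lock \<Gamma> (comp1 M \<mu> \<nu>))"
| ctx_eq_refl: "ctx M m \<Gamma> \<Longrightarrow> ctx_eq M m \<Gamma> \<Gamma>"
| ctx_eq_sym: "ctx_eq M m \<Gamma> \<Gamma>' \<Longrightarrow> ctx_eq M m \<Gamma>' \<Gamma>"
| ctx_eq_trans: "\<lbrakk>ctx_eq M m \<Gamma> \<Gamma>'; ctx_eq M m \<Gamma>' \<Gamma>''\<rbrakk> \<Longrightarrow> ctx_eq M m \<Gamma> \<Gamma>''"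
| ctx_eq_Ext: "\<lbrakk>ctx_eq M m \<Gamma> \<Gamma>'; modality M \<mu> n m; wff M n \<phi>\<rbrakk>
    \<Longrightarrow> ctx_eq M m (Ext \<Gamma> \<mu> \<phi>) (Ext \<Gamma>' \<mu> \<phi>)"
| ctx_eq_Lock: "\<lbrakk>ctx_eq M m \<Gamma> \<Gamma>'; modality M \<mu> n m\<rbrakk>
    \<Longrightarrow> ctx_eq M n (Lock \<Gamma> \<mu>) (Lock \<Gamma>' \<mu>)"

text \<open>\<open>locks M m \<Delta>\<close> is \<open>|\<Delta>|\<close> for a telescope \<open>\<Delta>\<close> that is appended to a context at mode
  \<open>m\<close>; the mode determines which identity \<open>|\<cdot>|\<close> is.\<close>

primrec locks :: "('o, 'm, 't) two_cat \<Rightarrow> 'o \<Rightarrow> ('p, 'm) pctx \<Rightarrow> 'm" where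
  "locks M m Emp = id1 M m"
| "locks M m (Ext \<Delta> \<mu> \<phi>) = locks M m \<Delta>"
| "locks M m (Lock \<Delta> \<mu>) = comp1 M (locks M m \<Delta>) \<mu>"


section \<open>Natural deduction\<close>

text \<open>\<open>derivable M m \<Gamma> \<phi>\<close> is \<open>\<Gamma> \<turnstile> \<phi> @ m\<close>. The judgement presupposes that \<open>\<Gamma>\<close> is a
  context and \<open>\<phi>\<close> a formula at \<open>m\<close>; a rule has a well-formedness premise only where this
  is not already guaranteed by its other premises, see \<open>derivable_wf\<close> below. The rule
  \<open>conv\<close> expresses that contexts are identified modulo \<open>ctx_eq\<close>.\<close>

inductive derivable ::
  "('o, 'm, 't) two_cat \<Rightarrow> 'o \<Rightarrow> ('p, 'm) pctx \<Rightarrow> ('p, 'm) fm \<Rightarrow> bool"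
  for M :: "('o, 'm, 't) two_cat"
where
  conv: "\<lbrakk>ctx_eq M m \<Gamma> \<Gamma>'; derivable M m \<Gamma> \<phi>\<rbrakk> \<Longrightarrow> derivable M m \<Gamma>' \<phi>"
| var: "\<lbrakk>ctx M n (cat (Ext \<Gamma> \<mu> \<phi>) \<Delta>); modality M \<mu> n m;
      transformation M \<alpha> \<mu> (locks M m \<Delta>)\<rbrakk>
    \<Longrightarrow> derivable M n (cat (Ext \<Gamma> \<mu> \<phi>) \<Delta>) \<phi>"
| TopI: "ctx M m \<Gamma> \<Longrightarrow> derivable M m \<Gamma> Top"
| BotE: "\<lbrakk>derivable M m \<Gamma> Bot; wff M m \<phi>\<rbrakk> \<Longrightarrow> derivable M m \<Gamma> \<phi>"
| AndI: "\<lbrakk>derivable M m \<Gamma> \<phi>; derivable M m \<Gamma> \<psi>\<rbrakk> \<Longrightarrow> derivable M m \<Gamma> (And \<phi> \<psi>)"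
| AndE1: "derivable M m \<Gamma> (And \<phi> \<psi>) \<Longrightarrow> derivable M m \<Gamma> \<phi>"
| AndE2: "derivable M m \<Gamma> (And \<phi> \<psi>) \<Longrightarrow> derivable M m \<Gamma> \<psi>"
| OrI1: "\<lbrakk>derivable M m \<Gamma> \<phi>; wff M m \<psi>\<rbrakk> \<Longrightarrow> derivable M m \<Gamma> (Or \<phi> \<psi>)"
| OrI2: "\<lbrakk>derivable M m \<Gamma> \<psi>; wff M m \<phi>\<rbrakk> \<Longrightarrow> derivable M m \<Gamma> (Or \<phi> \<psi>)"
| OrE: "\<lbrakk>derivable M m \<Gamma> (Or \<phi> \<psi>); derivable M m (Ext \<Gamma> (id1 M m) \<phi>) C;
      derivable M m (Ext \<Gamma> (id1 M m) \<psi>) C\<rbrakk>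
    \<Longrightarrow> derivable M m \<Gamma> C"
| ImpI: "derivable M m (Ext \<Gamma> \<mu> \<phi>) \<psi> \<Longrightarrow> derivable M m \<Gamma> (Imp \<mu> \<phi> \<psi>)"
| ImpE: "\<lbrakk>modality M \<mu> n m; derivable M m \<Gamma> (Imp \<mu> \<phi> \<psi>); derivable M n (Lock \<Gamma> \<mu>) \<phi>\<rbrakk>
    \<Longrightarrow> derivable M m \<Gamma> \<psi>"
| BoxI: "\<lbrakk>modality M \<mu> n m; derivable M n (Lock \<Gamma> \<mu>) \<phi>\<rbrakk>
    \<Longrightarrow> derivable M m \<Gamma> (Box \<mu> \<phi>)"
| BoxE: "\<lbrakk>modality M \<nu> k n; modality M \<mu> n m; derivable M n (Lock \<Gamma> \<mu>) (Box \<nu> \<phi>);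
      derivable M m (Ext \<Gamma> (comp1 M \<mu> \<nu>) \<phi>) \<psi>\<rbrakk>
    \<Longrightarrow> derivable M m \<Gamma> \<psi>"

lemma modality_unique:
  "modality M \<mu> n m \<Longrightarrow> modality M \<mu> n' m' \<Longrightarrow> n' = n \<and> m' = m"
  by (auto simp: modality_def)

inductive_cases wff_OrE: "wff M m (Or \<phi> \<psi>)"
inductive_cases wff_AndE: "wff M m (And \<phi> \<psi>)"
inductive_cases wff_ImpE: "wff M m (Imp \<mu> \<phi> \<psi>)"
inductive_cases wff_BoxE: "wff M m (Box \<mu> \<phi>)"
inductive_cases ctx_ExtE: "ctx M m (Ext \<Gamma> \<mu> \<phi>)"
inductive_cases ctx_LockE: "ctx M m (Lock \<Gamma> \<mu>)"

lemma ctx_catD: "ctx M n (cat \<Gamma> \<Delta>) \<Longrightarrow> \<exists>m. ctx M m \<Gamma>"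
  by (induction \<Delta> arbitrary: n) (auto elim: ctx_ExtE ctx_LockE)

context mode_theory
begin

lemma ctx_mode: "ctx M m \<Gamma> \<Longrightarrow> m \<in> modes M"
  by (induction rule: ctx.induct) (auto dest: modality_modes)

lemma ctx_eq_ctx: "ctx_eq M m \<Gamma> \<Gamma>' \<Longrightarrow> ctx M m \<Gamma> \<and> ctx M m \<Gamma>'"
  by (induction rule: ctx_eq.induct)
    (auto intro: ctx.intros id1_modality comp1_modality dest: ctx_mode)

lemma derivable_wf: "derivable M m \<Gamma> \<phi> \<Longrightarrow> ctx M m \<Gamma> \<and> wff M m \<phi>"
proof (induction rule: derivable.induct)
  case (var n \<Gamma> \<mu> \<phi> \<Delta> m \<alpha>)
  obtain m' where "ctx M m' (Ext \<Gamma> \<mu> \<phi>)"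
    using ctx_catD[OF var.hyps(1)] by blast
  then have "wff M n \<phi>"
    using var.hyps(2) by (auto elim!: ctx_ExtE dest: modality_unique)
  then show ?case using var.hyps(1) by blast
next
  case (ImpI m \<Gamma> \<mu> \<phi> \<psi>)
  then show ?case by (auto elim!: ctx_ExtE intro: wff_Imp)
next
  case (BoxI \<mu> n m \<Gamma> \<phi>)
  then show ?case by (auto elim!: ctx_LockE intro: wff_Box dest: modality_unique)
qed (auto dest: ctx_eq_ctx ctx_mode intro: wff.intros elim: wff_AndE wff_ImpE ctx_ExtE)

end

end

theory Submission
  imports Defs
begin

text \<open>Whether the variable rule applies to a hypothesis \<open>(\<mu> | \<phi>)\<close> of a context depends only on
  \<open>\<mu>\<close>, \<open>\<phi>\<close> and the composite of the locks to its right. The set of these triples is invariant under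
  the identification of contexts, and inclusion of such sets is preserved by extending or locking
  both contexts. So derivability is monotone in this set, by induction on
  derivations. Weakening enlarges the set, and exchange leaves it unchanged.\<close>

text \<open>In a well-formed context, \<open>tgt M \<mu>\<close> is the mode at which the hypothesis
  was added. Reading it off the modality lets \<open>hyps\<close> do without the mode argument of
  \<open>locks\<close>.\<close>

primrec hyps :: "('o, 'm, 't) two_cat \<Rightarrow> ('p, 'm) pctx \<Rightarrow> ('m \<times> ('p, 'm) fm \<times> 'm) set" where
  "hyps M Emp = {}"
| "hyps M (Ext \<Gamma> \<mu> \<phi>) = insert (\<mu>, \<phi>, id1 M (tgt M \<mu>)) (hyps M \<Gamma>)"
| "hyps M (Lock \<Gamma> \<nu>) = (\<lambda>(\<mu>, \<phi>, \<kappa>). (\<mu>, \<phi>, comp1 M \<kappa> \<nu>)) ` hyps M \<Gamma>"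

lemma hyps_Lock_mono: "hyps M \<Gamma> \<subseteq> hyps M \<Gamma>' \<Longrightarrow> hyps M (Lock \<Gamma> \<mu>) \<subseteq> hyps M (Lock \<Gamma>' \<mu>)"
  by (simp add: image_mono)

lemma hyps_Ext_mono: "hyps M \<Gamma> \<subseteq> hyps M \<Gamma>' \<Longrightarrow> hyps M (Ext \<Gamma> \<mu> \<phi>) \<subseteq> hyps M (Ext \<Gamma>' \<mu> \<phi>)"
  by auto

lemma hyps_cat_mono: "hyps M \<Gamma> \<subseteq> hyps M \<Gamma>' \<Longrightarrow> hyps M (cat \<Gamma> \<Delta>) \<subseteq> hyps M (cat \<Gamma>' \<Delta>)"
proof (induction \<Delta>)
  case (Ext \<Delta> \<mu> \<phi>)
  then show ?case using hyps_Ext_mono by (metis cat.simps(2))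
next
  case (Lock \<Delta> \<mu>)
  then show ?case using hyps_Lock_mono by (metis cat.simps(3))
qed simp

lemma hyps_catI: "(\<mu>, \<phi>, locks M (tgt M \<mu>) \<Delta>) \<in> hyps M (cat (Ext \<Gamma> \<mu> \<phi>) \<Delta>)"
  by (induction \<Delta>) force+

text \<open>Converse of \<open>hyps_catI\<close>: membership yields a splitting of the shape that
  rule \<open>var\<close> demands. Equal triples from different positions coincide in the set, so
  some occurrence is recovered, not a prescribed one.\<close>

lemma hyps_catE:
  assumes "(\<mu>, \<phi>, \<kappa>) \<in> hyps M \<Gamma>"
  obtains \<Gamma>\<^sub>0 \<Delta> where "\<Gamma> = cat (Ext \<Gamma>\<^sub>0 \<mu> \<phi>) \<Delta>" and "\<kappa> = locks M (tgt M \<mu>) \<Delta>"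
proof -
  have "\<exists>\<Gamma>\<^sub>0 \<Delta>. \<Gamma> = cat (Ext \<Gamma>\<^sub>0 \<mu> \<phi>) \<Delta> \<and> \<kappa> = locks M (tgt M \<mu>) \<Delta>"
    using assms
  proof (induction \<Gamma> arbitrary: \<kappa>)
    case (Ext \<Gamma> \<nu> \<psi>)
    show ?case
    proof (cases "(\<mu>, \<phi>, \<kappa>) \<in> hyps M \<Gamma>")
      case True
      then obtain \<Gamma>\<^sub>0 \<Delta> where "\<Gamma> = cat (Ext \<Gamma>\<^sub>0 \<mu> \<phi>) \<Delta>" "\<kappa> = locks M (tgt M \<mu>) \<Delta>"
        using Ext.IH by blast
      then have "Ext \<Gamma> \<nu> \<psi> = cat (Ext \<Gamma>\<^sub>0 \<mu> \<phi>) (Ext \<Delta> \<nu> \<psi>) \<and> \<kappa> = locks M (tgt M \<mu>) (Ext \<Delta> \<nu> \<psi>)"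
        by simp
      then show ?thesis by blast
    next
      case False
      \<comment> \<open>The triple can only come from the last entry, so nothing stands to its right
        and \<kappa> is an identity.\<close>
      then show ?thesis
        using Ext.prems by (intro exI[of _ \<Gamma>] exI[of _ Emp]) simp
    qed
  next
    case (Lock \<Gamma> \<nu>)
    then obtain \<kappa>' where "(\<mu>, \<phi>, \<kappa>') \<in> hyps M \<Gamma>" and \<kappa>: "\<kappa> = comp1 M \<kappa>' \<nu>"
      by auto
    then obtain \<Gamma>\<^sub>0 \<Delta> where "\<Gamma> = cat (Ext \<Gamma>\<^sub>0 \<mu> \<phi>) \<Delta>" "\<kappa>' = locks M (tgt M \<mu>) \<Delta>"
      using Lock.IH by blast
    with \<kappa> have "Lock \<Gamma> \<nu> = cat (Ext \<Gamma>\<^sub>0 \<mu> \<phi>) (Lock \<Delta> \<nu>) \<and> \<kappa> = locks M (tgt M \<mu>) (Lock \<Delta> \<nu>)"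
      by simp
    then show ?case by blast
  qed simp
  then show thesis using that by blast
qed

text \<open>Checking the entries of \<Delta> uses only the mode of the context below them. The
  assumption ranges over all modes because the locks in \<Delta> make the mode below differ from
  \<open>p\<close>.\<close>

lemma ctx_cat_mono:
  assumes "\<And>m. ctx M m \<Gamma> \<Longrightarrow> ctx M m \<Gamma>'" and "ctx M p (cat \<Gamma> \<Delta>)"
  shows "ctx M p (cat \<Gamma>' \<Delta>)"
  using assms(2)
  by (induction \<Delta> arbitrary: p) (auto intro: assms(1) ctx.intros elim!: ctx_ExtE ctx_LockE)

lemma ctx_Ext_transfer: "ctx M m (Ext \<Gamma> \<mu> \<phi>) \<Longrightarrow> ctx M m \<Gamma>' \<Longrightarrow> ctx M m (Ext \<Gamma>' \<mu> \<phi>)"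
  by (auto intro: ctx.intros elim!: ctx_ExtE)

context mode_theory
begin

text \<open>Typing of the recorded composites: they run from the current mode back to the mode where
  the hypothesis was added. The unit and associativity laws hold only for typed modalities, so this
  is what makes them applicable.\<close>

lemma hyps_modality:
  "ctx M m \<Gamma> \<Longrightarrow> (\<mu>, \<phi>, \<kappa>) \<in> hyps M \<Gamma> \<Longrightarrow> modality M \<kappa> m (tgt M \<mu>)"
proof (induction arbitrary: \<kappa> rule: ctx.induct)
  case (ctx_Ext m \<Gamma> \<nu> n \<psi>)
  then have "tgt M \<nu> = m" and "m \<in> modes M"
    using modality_modes by (auto simp: modality_def)
  then show ?case using ctx_Ext id1_modality by auto
next
  case (ctx_Lock m \<Gamma> \<nu> n)
  then show ?case by (auto intro: comp1_modality)
qed simp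

text \<open>This is the right unit law, applied to each triple.\<close>

lemma hyps_Lock_id:
  assumes "ctx M m \<Gamma>"
  shows "hyps M (Lock \<Gamma> (id1 M m)) = hyps M \<Gamma>"
proof -
  have "(\<lambda>(\<mu>, \<phi>, \<kappa>). (\<mu>, \<phi>, comp1 M \<kappa> (id1 M m))) x = x" if "x \<in> hyps M \<Gamma>" for x
    using that by (cases x) (auto intro: comp1_id_right dest: hyps_modality[OF assms])
  then show ?thesis by simp
qed

text \<open>This is associativity of composition, applied to each triple.\<close>

lemma hyps_Lock_comp:
  assumes "ctx M m \<Gamma>" and "modality M \<mu> n m" and "modality M \<nu> k n"
  shows "hyps M (Lock (Lock \<Gamma> \<mu>) \<nu>) = hyps M (Lock \<Gamma> (comp1 M \<mu> \<nu>))"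
  unfolding hyps.simps image_image
proof (rule image_cong[OF refl])
  fix x assume "x \<in> hyps M \<Gamma>"
  then show "(case case x of (\<rho>, \<phi>, \<kappa>) \<Rightarrow> (\<rho>, \<phi>, comp1 M \<kappa> \<mu>) of
        (\<rho>, \<phi>, \<kappa>) \<Rightarrow> (\<rho>, \<phi>, comp1 M \<kappa> \<nu>)) =
      (case x of (\<rho>, \<phi>, \<kappa>) \<Rightarrow> (\<rho>, \<phi>, comp1 M \<kappa> (comp1 M \<mu> \<nu>)))"
    using assms(2,3) by (cases x) (auto intro: comp1_assoc dest: hyps_modality[OF assms(1)])
qed

text \<open>Only the two generating equations have content: \<open>hyps\<close> of an extended or
  locked context is a function of \<open>hyps\<close> of the context below, which settles the
  congruence rules.\<close>

lemma hyps_ctx_eq: "ctx_eq M m \<Gamma> \<Gamma>' \<Longrightarrow> hyps M \<Gamma> = hyps M \<Gamma>'"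
proof (induction rule: ctx_eq.induct)
  case (ctx_eq_lock_id m \<Gamma>)
  then show ?case by (rule hyps_Lock_id)
next
  case (ctx_eq_lock_comp m \<Gamma> \<mu> n \<nu> k)
  then show ?case by (rule hyps_Lock_comp)
qed simp_all

text \<open>An induction on contexts of the form \<open>cat \<Gamma> \<Delta>\<close> would break at
  \<open>conv\<close>, which can destroy that form. Inclusion of hypothesis sets survives
  it.\<close>

theorem derivable_hyps_mono:
  "derivable M m \<Gamma> C \<Longrightarrow> ctx M m \<Gamma>' \<Longrightarrow> hyps M \<Gamma> \<subseteq> hyps M \<Gamma>' \<Longrightarrow> derivable M m \<Gamma>' C"
proof (induction arbitrary: \<Gamma>' rule: derivable.induct)
  case (conv m \<Gamma> \<Gamma>'' \<phi>)
  \<comment> \<open>Conversion leaves the hypothesis set alone, so the induction hypothesis applies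
    directly to the same target context.\<close>
  show ?case
    using conv.prems hyps_ctx_eq[OF conv.hyps(1)] by (intro conv.IH) simp_all
next
  case (var n \<Gamma> \<mu> \<phi> \<Delta> m \<alpha>)
  have tgt: "tgt M \<mu> = m"
    using var.hyps(2) by (simp add: modality_def)
  have "(\<mu>, \<phi>, locks M (tgt M \<mu>) \<Delta>) \<in> hyps M \<Gamma>'"
    using subsetD[OF var.prems(2) hyps_catI] .
  \<comment> \<open>The new splitting has the same lock composite as the old one, so the same 2-cell
    \<alpha> justifies \<open>var\<close>.\<close>
  then obtain \<Gamma>\<^sub>0 \<Delta>' where "\<Gamma>' = cat (Ext \<Gamma>\<^sub>0 \<mu> \<phi>) \<Delta>'" "locks M m \<Delta> = locks M m \<Delta>'"
    by (rule hyps_catE) (simp add: tgt)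
  then show ?case
    using derivable.var[of M n \<Gamma>\<^sub>0 \<mu> \<phi> \<Delta>' m \<alpha>] var.hyps(2,3) var.prems(1) by simp
next
  case (OrE m \<Gamma> \<phi> \<psi> C)
  \<comment> \<open>The induction hypotheses ask for well-formed target contexts; the added entries
    are well formed because they occur in derivable premises.\<close>
  have "ctx M m (Ext \<Gamma>' (id1 M m) \<phi>)" "ctx M m (Ext \<Gamma>' (id1 M m) \<psi>)"
    using OrE.hyps(2,3)[THEN derivable_wf] OrE.prems(1) by (auto intro: ctx_Ext_transfer)
  then show ?case
    by (intro derivable.OrE[OF OrE.IH] hyps_Ext_mono OrE.prems)
next
  case (ImpI m \<Gamma> \<mu> \<phi> \<psi>)
  have "ctx M m (Ext \<Gamma>' \<mu> \<phi>)"
    using derivable_wf[OF ImpI.hyps] ImpI.prems(1) by (auto intro: ctx_Ext_transfer)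
  then show ?case
    by (intro derivable.ImpI ImpI.IH hyps_Ext_mono ImpI.prems)
next
  case (ImpE \<mu> n m \<Gamma> \<phi> \<psi>)
  show ?case
    by (intro derivable.ImpE[OF ImpE.hyps(1) ImpE.IH] ctx_Lock[OF _ ImpE.hyps(1)] hyps_Lock_mono
        ImpE.prems)
next
  case (BoxI \<mu> n m \<Gamma> \<phi>)
  show ?case
    by (intro derivable.BoxI[OF BoxI.hyps(1) BoxI.IH] ctx_Lock[OF _ BoxI.hyps(1)] hyps_Lock_mono
        BoxI.prems)
next
  case (BoxE \<nu> k n \<mu> m \<Gamma> \<phi> \<psi>)
  have "ctx M m (Ext \<Gamma>' (comp1 M \<mu> \<nu>) \<phi>)" "ctx M n (Lock \<Gamma>' \<mu>)"
    using derivable_wf[OF BoxE.hyps(4)] BoxE.hyps(2) BoxE.prems(1)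
    by (auto intro: ctx_Ext_transfer ctx_Lock)
  then show ?case
    by (intro derivable.BoxE[OF BoxE.hyps(1,2) BoxE.IH] hyps_Ext_mono hyps_Lock_mono BoxE.prems)
next
  case TopI
  then show ?case by (intro derivable.TopI)
next
  case BotE
  show ?case by (intro derivable.BotE[OF BotE.IH] BotE.hyps(2) BotE.prems)
next
  case AndI
  show ?case by (intro derivable.AndI[OF AndI.IH] AndI.prems)
next
  case AndE1
  show ?case by (intro derivable.AndE1[OF AndE1.IH] AndE1.prems)
next
  case AndE2
  show ?case by (intro derivable.AndE2[OF AndE2.IH] AndE2.prems)
next
  case OrI1
  show ?case by (intro derivable.OrI1[OF OrI1.IH] OrI1.hyps(2) OrI1.prems)
next
  case OrI2
  show ?case by (intro derivable.OrI2[OF OrI2.IH] OrI2.hyps(2) OrI2.prems)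
qed

corollary weakening:
  assumes "ctx M p (cat (Ext \<Gamma> \<mu> \<phi>) \<Delta>)" and "derivable M p (cat \<Gamma> \<Delta>) C"
  shows "derivable M p (cat (Ext \<Gamma> \<mu> \<phi>) \<Delta>) C"
proof -
  have "hyps M (cat \<Gamma> \<Delta>) \<subseteq> hyps M (cat (Ext \<Gamma> \<mu> \<phi>) \<Delta>)"
    by (rule hyps_cat_mono) auto
  with assms show ?thesis using derivable_hyps_mono by blast
qed

corollary exchange:
  assumes "derivable M p (cat (Ext (Ext \<Gamma> \<mu> \<phi>) \<nu> \<psi>) \<Delta>) C"
  shows "derivable M p (cat (Ext (Ext \<Gamma> \<nu> \<psi>) \<mu> \<phi>) \<Delta>) C"
proof -
  have "ctx M p (cat (Ext (Ext \<Gamma> \<mu> \<phi>) \<nu> \<psi>) \<Delta>)"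
    using assms derivable_wf by blast
  then have "ctx M p (cat (Ext (Ext \<Gamma> \<nu> \<psi>) \<mu> \<phi>) \<Delta>)"
    \<comment> \<open>Neither entry is a lock, so both are checked at the same mode and may be
      swapped.\<close>
    by (rule ctx_cat_mono[rotated]) (auto intro: ctx.intros elim!: ctx_ExtE)
  moreover have "hyps M (cat (Ext (Ext \<Gamma> \<mu> \<phi>) \<nu> \<psi>) \<Delta>) \<subseteq> hyps M (cat (Ext (Ext \<Gamma> \<nu> \<psi>) \<mu> \<phi>) \<Delta>)"
    by (rule hyps_cat_mono) auto
  ultimately show ?thesis using assms derivable_hyps_mono by blast
qed

end

theorem theorem1:
  fixes M :: "('o, 'm, 't) two_cat"
  assumes "mode_theory M"
  shows "(\<forall>p (\<Gamma> :: ('p, 'm) pctx) \<Delta> \<mu> \<phi> C.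
            ctx M p (cat (Ext \<Gamma> \<mu> \<phi>) \<Delta>) \<and> derivable M p (cat \<Gamma> \<Delta>) C
              \<longrightarrow> derivable M p (cat (Ext \<Gamma> \<mu> \<phi>) \<Delta>) C)
       \<and> (\<forall>p (\<Gamma> :: ('p, 'm) pctx) \<Delta> \<mu> \<nu> \<phi> \<psi> C.
            derivable M p (cat (Ext (Ext \<Gamma> \<mu> \<phi>) \<nu> \<psi>) \<Delta>) C
              \<longrightarrow> derivable M p (cat (Ext (Ext \<Gamma> \<nu> \<psi>) \<mu> \<phi>) \<Delta>) C)"
  using mode_theory.weakening[OF assms] mode_theory.exchange[OF assms] by blast

end
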